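(* For every integer $m\ge2$, $$f^{(m)}_1(1)=\frac{m-1}{2},$$ and for every integer $k\ge2$, $$f^{(m)}_k(1)=\frac{1}{(k-1)!}\sum_{j=2}^{k}\frac{B_j}{j}\,\mathrm{stirl}(k-1,j-1)\,(m^j-1).$$
   Context: For $m\ge2$, $\Psi_m(x)=1+x+\cdots+x^{m-1}$ and $f^{(m)}_k(x)=\big(-\tfrac1m x\Psi_m'(x)\big)^k\ \mathrm{rem}\ \Psi_m(x)$, where $f\ \mathrm{rem}\ q$ denotes the remainder of $f$ on Euclidean division by $q$. $B_j$ are the Bernoulli numbers ($\frac{t}{e^t-1}=\sum_{j\ge0}B_jt^j/j!$). $\mathrm{stirl}(k,j)$ are the unsigned Stirling numbers of the first kind, satisfying $\mathrm{stirl}(k,j)=\mathrm{stirl}(k-1,j-1)+(k-1)\,\mathrm{stirl}(k-1,j)$, $\mathrm{stirl}(0,0)=1$. *)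

theory Defs
  imports
    "HOL-Computational_Algebra.Computational_Algebra"
    "HOL-Combinatorics.Stirling"
begin

definition Psi :: "nat \<Rightarrow> rat poly" where
  "Psi m = (\<Sum>i<m. monom 1 i)"

definition f_poly :: "nat \<Rightarrow> nat \<Rightarrow> rat poly" where
  "f_poly m k = (smult (- (1 / of_nat m)) (monom 1 1 * pderiv (Psi m))) ^ k mod Psi m"

definition bernoulli :: "nat \<Rightarrow> rat" where
  "bernoulli j = fact j * fps_nth (fps_X / (fps_exp 1 - 1)) j"

(* Division of formal power series over a field is total and truncates when the divisor
   has the larger subdegree; here it is exact. *)
lemma bernoulli_fps_exact:
  "fps_X / (fps_exp 1 - 1) * (fps_exp 1 - 1) = (fps_X :: rat fps)"
proof -
  have "subdegree (fps_exp 1 - 1 :: rat fps) = 1"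
    by (rule subdegreeI) auto
  then have "(fps_exp 1 - 1 :: rat fps) dvd fps_X"
    by (subst fps_dvd_iff) auto
  then show ?thesis
    by (rule dvd_div_mult_self)
qed

end

theory Submission
  imports Defs
begin

text \<open>
  At a root of \<open>\<Psi>\<^sub>m\<close>, the polynomial \<open>- x \<Psi>\<^sub>m'(x) / m\<close> takes the value
  \<open>1 / (1 - x)\<close>. Hence \<open>(1 - x)^k f\<^sub>k(x) = 1 + \<Psi>\<^sub>m(x) h(x)\<close> with \<open>deg h < k\<close>, and expanding
  at \<open>x = 1 - z\<close> shows that \<open>f\<^sub>k(1)\<close> is the coefficient of \<open>z^k\<close> in
  \<open>A(z) = m / \<Psi>\<^sub>m(1 - z) = m z / (1 - (1 - z)^m)\<close>. Substituting \<open>z = 1 - e^(-t)\<close> turns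
  \<open>(A(z) - 1) / z\<close> into \<open>m / (e^(m t) - 1) - 1 / (e^t - 1) + m - 1\<close>, whose expansion in \<open>t\<close> is
  governed by the Bernoulli numbers, and the powers of \<open>t = - ln (1 - z)\<close> have the Stirling
  numbers as coefficients.
\<close>

section \<open>The series \<open>- ln (1 - z)\<close>\<close>

text \<open>The constant coefficient is \<open>1 / 0 = 0\<close>.\<close>
definition neg_ln :: "'a::field_char_0 fps" where
  "neg_ln = Abs_fps (\<lambda>n. 1 / of_nat n)"

lemma neg_ln_nth_0 [simp]: "fps_nth neg_ln 0 = 0"
  by (simp add: neg_ln_def)

lemma neg_ln_neq_0 [simp]: "(neg_ln :: 'a::field_char_0 fps) \<noteq> 0"
proof
  assume "(neg_ln :: 'a fps) = 0"
  then have "fps_nth (neg_ln :: 'a fps) 1 = 0" by simp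
  then show False by (simp add: neg_ln_def)
qed

lemma neg_ln_deriv: "(1 - fps_X) * fps_deriv neg_ln = (1 :: 'a::field_char_0 fps)"
proof (rule fps_ext)
  fix n
  have *: "fps_deriv (neg_ln :: 'a fps) = Abs_fps (\<lambda>n. 1)"
    by (simp add: neg_ln_def fps_eq_iff del: of_nat_Suc)
  show "fps_nth ((1 - fps_X) * fps_deriv neg_ln) n = fps_nth (1 :: 'a fps) n"
    unfolding * by (simp add: algebra_simps)
qed

text \<open>Multiplying the derivative of the power \<open>Suc j\<close> by \<open>1 - fps_X\<close>
  leaves \<open>Suc j\<close> times the power \<open>j\<close>. Comparing coefficients gives a
  recurrence which, after scaling by factorials, is the triangular recurrence of the Stirling
  numbers.\<close>

lemma neg_ln_power_nth:
  "fps_nth (neg_ln ^ j :: 'a::field_char_0 fps) n = fact j * of_nat (stirling n j) / fact n"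
proof (induction j arbitrary: n)
  case 0
  then show ?case by (cases n) auto
next
  case (Suc j)
  have "(1 - fps_X) * fps_deriv (neg_ln ^ Suc j)
      = of_nat (Suc j) * neg_ln ^ j * ((1 - fps_X) * fps_deriv neg_ln :: 'a fps)"
    by (simp only: fps_deriv_power' diff_Suc_1 mult_ac)
  then have deriv: "(1 - fps_X) * fps_deriv (neg_ln ^ Suc j) = of_nat (Suc j) * (neg_ln ^ j :: 'a fps)"
    by (simp only: neg_ln_deriv mult_1_right)
  have rec: "of_nat (Suc n) * fps_nth (neg_ln ^ Suc j :: 'a fps) (Suc n)
      = of_nat n * fps_nth (neg_ln ^ Suc j) n + of_nat (Suc j) * fps_nth (neg_ln ^ j) n" for n
  proof -
    have "fps_nth ((1 - fps_X) * fps_deriv (neg_ln ^ Suc j :: 'a fps)) n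
        = fps_nth (of_nat (Suc j) * neg_ln ^ j) n"
      by (simp only: deriv)
    then show ?thesis
      by (cases n) (simp_all add: left_diff_distrib fps_of_nat[symmetric] algebra_simps
          del: of_nat_Suc power_Suc)
  qed
  show ?case
  proof (induction n)
    case 0
    then show ?case by simp
  next
    case (Suc n)
    have "of_nat (Suc n) * fps_nth (neg_ln ^ Suc j :: 'a fps) (Suc n)
        = of_nat (Suc n) * (fact (Suc j) * of_nat (stirling (Suc n) (Suc j)) / fact (Suc n))"
      unfolding rec Suc.IH \<open>\<And>n. fps_nth (neg_ln ^ j :: 'a fps) n = _\<close>
      by (simp add: field_simps del: of_nat_Suc)
    then show ?case
      by (simp only: mult_cancel_left of_nat_eq_0_iff) simp
  qed
qed

text \<open>The product has derivative zero and constant coefficient 1. This justifies reading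
  \<open>1 - fps_X\<close> as e^(-t) once t is replaced by \<open>neg_ln\<close>.\<close>

lemma exp_compose_neg_ln:
  "(1 - fps_X) ^ m * (fps_exp (of_nat m) oo neg_ln) = (1 :: 'a::field_char_0 fps)"
proof (cases m)
  case 0
  then show ?thesis by simp
next
  case (Suc l)
  define E where "E = (fps_exp (of_nat m) oo neg_ln :: 'a fps)"
  define F where "F = (1 - fps_X) ^ m * E"
  have E': "fps_deriv E = of_nat m * E * fps_deriv neg_ln"
    by (simp add: E_def fps_compose_deriv fps_compose_mult_distrib fps_of_nat[symmetric] del: of_nat_Suc)
  \<comment> \<open>The two terms of the product rule share a factor; the bracket that remains
    vanishes by \<open>neg_ln_deriv\<close>.\<close>
  have "fps_deriv F = of_nat m * (1 - fps_X) ^ l * E * ((1 - fps_X) * fps_deriv neg_ln - 1)"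
    unfolding F_def fps_deriv_mult fps_deriv_power' E' Suc diff_Suc_1
    by (simp add: algebra_simps)
  then have "fps_deriv F = 0"
    by (simp only: neg_ln_deriv) simp
  then have "F = fps_const (fps_nth F 0)"
    by (simp only: fps_deriv_eq_0_iff)
  also have "fps_nth F 0 = 1"
    by (simp add: F_def E_def fps_nth_power_0)
  finally show ?thesis by (simp add: F_def E_def)
qed

section \<open>Bernoulli numbers\<close>

lemma fps_compose_const_mult_X_nth:
  "fps_nth (a oo (fps_const c * fps_X)) n = c ^ n * fps_nth (a :: 'a::comm_ring_1 fps) n"
proof -
  have "fps_nth (a oo (fps_const c * fps_X)) n = (\<Sum>i=0..n. if i = n then c ^ n * fps_nth a n else 0)"
    unfolding fps_compose_nth
    by (intro sum.cong) (auto simp: power_mult_distrib)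
  then show ?thesis by simp
qed

definition bernoulli_fps :: "rat fps" where
  "bernoulli_fps = fps_X / (fps_exp 1 - 1)"

lemma bernoulli_fps_nth: "fps_nth bernoulli_fps j = bernoulli j / fact j"
  by (simp add: bernoulli_def bernoulli_fps_def)

lemma bernoulli_fps_scaled:
  "(bernoulli_fps oo (fps_const c * fps_X)) * (fps_exp c - 1) = fps_const c * fps_X"
proof -
  have "bernoulli_fps * (fps_exp 1 - 1) = fps_X"
    unfolding bernoulli_fps_def by (rule bernoulli_fps_exact)
  then have "(bernoulli_fps * (fps_exp 1 - 1)) oo (fps_const c * fps_X) = fps_const c * fps_X"
    by simp
  then show ?thesis
    by (simp add: fps_compose_mult_distrib fps_compose_sub_distrib)
qed

lemma bernoulli_1: "bernoulli 1 = - 1 / 2"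
proof -
  have *: "bernoulli_fps * (fps_exp 1 - 1) = fps_X"
    unfolding bernoulli_fps_def by (rule bernoulli_fps_exact)
  have 1: "fps_nth (bernoulli_fps * (fps_exp 1 - 1)) 1 = 1"
    and 2: "fps_nth (bernoulli_fps * (fps_exp 1 - 1)) 2 = 0"
    unfolding * by simp_all
  from 1 have "fps_nth bernoulli_fps 0 = 1"
    by (simp add: fps_mult_nth)
  with 2 have "fps_nth bernoulli_fps 1 = - 1 / 2"
    by (simp add: fps_mult_nth numeral_2_eq_2)
  then show ?thesis by (simp add: bernoulli_fps_nth)
qed

section \<open>The coefficients of \<open>m z / (1 - (1 - z)^m)\<close>\<close>

text \<open>With B(t) = t / (e^t - 1), this is (B(m t) - B(t)) / t = m / (e^(m t) - 1) - 1 / (e^t -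
  1). The constant terms of B(m t) and B(t) cancel, so the division by t is a plain index
  shift.\<close>

definition bernoulli_diff :: "nat \<Rightarrow> rat fps" where
  "bernoulli_diff m = Abs_fps (\<lambda>j. bernoulli (Suc j) * (of_nat m ^ Suc j - 1) / fact (Suc j))"

lemma X_mult_bernoulli_diff:
  "fps_X * bernoulli_diff m = (bernoulli_fps oo (fps_const (of_nat m) * fps_X)) - bernoulli_fps"
proof (rule fps_ext)
  fix n
  show "fps_nth (fps_X * bernoulli_diff m) n =
      fps_nth ((bernoulli_fps oo (fps_const (of_nat m) * fps_X)) - bernoulli_fps) n"
    by (cases n) (simp_all add: fps_compose_const_mult_X_nth bernoulli_fps_nth bernoulli_diff_def
        right_diff_distrib diff_divide_distrib del: fact_Suc power_Suc)
qed

text \<open>With z = \<open>fps_X\<close>, U = (1 - z)^m = e^(-m t), the composed series is m U / (1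
  - U) - (1 - z) / z. Times z this is A U - (1 - z), and A U = A - m z by the equation for A. The
  proof clears all denominators.\<close>

lemma bernoulli_diff_compose_neg_ln:
  assumes A: "A * (1 - (1 - fps_X) ^ m) = of_nat m * fps_X" and m: "m > 0"
  shows "fps_X * (bernoulli_diff m oo neg_ln) = A - 1 - (of_nat m - 1) * fps_X"
proof -
  define D where "D = bernoulli_diff m oo neg_ln"
  define U where "U = ((1 - fps_X) ^ m :: rat fps)"
  define E where "E = (\<lambda>k. fps_exp (of_nat k) oo neg_ln :: rat fps)"
  define B where "B = (\<lambda>k. (bernoulli_fps oo (fps_const (of_nat k) * fps_X)) oo neg_ln)"
  have B: "B k * (E k - 1) = of_nat k * neg_ln" for k
  proof -
    have "((bernoulli_fps oo (fps_const (of_nat k) * fps_X)) * (fps_exp (of_nat k) - 1)) oo neg_ln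
        = (fps_const (of_nat k) * fps_X) oo neg_ln"
      by (simp only: bernoulli_fps_scaled)
    then show ?thesis
      by (simp add: B_def E_def fps_compose_mult_distrib fps_compose_sub_distrib fps_of_nat)
  qed
  have "(fps_X * bernoulli_diff m) oo neg_ln = B m - B 1"
    by (simp add: X_mult_bernoulli_diff fps_compose_sub_distrib B_def)
  then have LD: "neg_ln * D = B m - B 1"
    by (simp add: fps_compose_mult_distrib D_def)
  have UE: "U * E m = 1"
    unfolding U_def E_def by (rule exp_compose_neg_ln)
  have XE: "(1 - fps_X) * E 1 = 1"
    using exp_compose_neg_ln[of 1] by (simp add: E_def)
  \<comment> \<open>Here 1 - e^(-m t) = e^(-m t) (e^(m t) - 1); \<open>B1\<close> is the same
    computation for exponent 1, where 1 - U becomes \<open>fps_X\<close>.\<close>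
  have Bm: "B m * (1 - U) = of_nat m * neg_ln * U"
  proof -
    have "B m * (1 - U) = B m * (U * E m - U)" by (simp only: UE)
    also have "\<dots> = U * (B m * (E m - 1))" by (simp add: algebra_simps)
    finally show ?thesis by (simp only: B mult_ac)
  qed
  have B1: "B 1 * fps_X = neg_ln * (1 - fps_X)"
  proof -
    have "B 1 * fps_X = B 1 * ((1 - fps_X) * E 1 - (1 - fps_X))" by (simp only: XE) simp
    also have "\<dots> = (1 - fps_X) * (B 1 * (E 1 - 1))" by (simp add: algebra_simps)
    finally show ?thesis by (simp only: B of_nat_1 mult_1_left mult_ac)
  qed
  have "neg_ln * ((fps_X * D) * (1 - U)) = (neg_ln * D) * (fps_X * (1 - U))"
    by (simp only: mult_ac)
  also have "\<dots> = (B m * (1 - U)) * fps_X - (B 1 * fps_X) * (1 - U)"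
    unfolding LD by (simp add: algebra_simps)
  also have "\<dots> = neg_ln * ((of_nat m * fps_X) * U - (1 - fps_X) * (1 - U))"
    unfolding Bm B1 by (simp add: algebra_simps)
  also have "\<dots> = neg_ln * ((A - 1 - (of_nat m - 1) * fps_X) * (1 - U))"
  proof -
    have "(A - 1 - (of_nat m - 1) * fps_X) * (1 - U)
        = A * (1 - U) - (of_nat m * fps_X) * (1 - U) - (1 - fps_X) * (1 - U)"
      by (simp add: algebra_simps)
    also have "A * (1 - U) = of_nat m * fps_X"
      using A by (simp add: U_def)
    finally show ?thesis by (simp only: right_diff_distrib mult_1_right diff_diff_eq2) simp
  qed
  finally have "(fps_X * D) * (1 - U) = (A - 1 - (of_nat m - 1) * fps_X) * (1 - U)"
    by simp
  \<comment> \<open>If this factor vanished, the equation for \<open>A\<close> would force m z =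
    0.\<close>
  moreover have "1 - U \<noteq> 0"
  proof
    assume "1 - U = 0"
    then have "fps_nth (of_nat m * fps_X :: rat fps) 1 = 0"
      using A by (simp only: U_def) simp
    with m show False by (simp add: fps_of_nat[symmetric])
  qed
  ultimately show ?thesis by (simp add: D_def)
qed

section \<open>The remainders\<close>

lemma Psi_mult: "(monom 1 1 - 1) * Psi m = monom 1 m - 1"
proof -
  have "(monom 1 1 :: rat poly) ^ m - 1 = (monom 1 1 - 1) * (\<Sum>i<m. monom 1 1 ^ i)"
    by (rule power_diff_1_eq)
  then show ?thesis by (simp add: Psi_def monom_power)
qed

lemma poly_Psi_1: "poly (Psi m) 1 = of_nat m"
  by (simp add: Psi_def poly_sum poly_monom)

lemma degree_Psi:
  assumes "m > 0"
  shows "degree (Psi m) = m - 1"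
proof (rule antisym)
  show "degree (Psi m) \<le> m - 1"
    unfolding Psi_def by (rule degree_sum_le) (auto simp: degree_monom_eq)
  have "coeff (Psi m) (m - 1) = 1"
    using assms by (simp add: Psi_def coeff_sum)
  then show "m - 1 \<le> degree (Psi m)"
    by (intro le_degree) simp
qed

text \<open>Differentiating (x - 1) \<Psi> = x^m - 1 and multiplying by x gives x (x - 1) \<Psi>' =
  m x^m - x \<Psi>, which is congruent to m modulo \<Psi>. So the base of the power is an inverse of
  1 - x modulo \<Psi>.\<close>

lemma f_poly_eq:
  assumes m: "m > 0"
  shows "\<exists>h. (1 - monom 1 1) ^ k * f_poly m k = 1 + Psi m * h"
proof -
  define w where "w = smult (- (1 / of_nat m)) (monom 1 1 * pderiv (Psi m))"
  let ?x = "monom 1 1 :: rat poly"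
  have "pderiv ((?x - 1) * Psi m) = pderiv (monom 1 m - 1)"
    by (simp only: Psi_mult)
  then have "Psi m + (?x - 1) * pderiv (Psi m) = monom (of_nat m) (m - 1)"
    by (simp add: pderiv_mult pderiv_diff pderiv_monom)
  then have "?x * (Psi m + (?x - 1) * pderiv (Psi m)) = smult (of_nat m) (monom 1 m)"
    using m by (simp add: mult_monom smult_monom)
  also have "\<dots> = smult (of_nat m) (1 + (?x - 1) * Psi m)"
    unfolding Psi_mult by simp
  finally have eq: "?x * (?x - 1) * pderiv (Psi m)
      = smult (of_nat m) (1 + (?x - 1) * Psi m) - ?x * Psi m"
    by (simp add: algebra_simps)
  have "(1 - ?x) * w = smult (1 / of_nat m) (?x * (?x - 1) * pderiv (Psi m))"
    by (simp add: w_def algebra_simps smult_diff_right)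
  also have "\<dots> = 1 + Psi m * (?x - 1 - smult (1 / of_nat m) ?x)"
    unfolding eq using m by (simp add: algebra_simps smult_diff_right smult_add_right)
  finally have "((1 - ?x) * w) mod Psi m = 1 mod Psi m"
    by simp
  then have "((1 - ?x) * w) ^ k mod Psi m = 1 mod Psi m"
    by (metis power_mod power_one)
  then have "((1 - ?x) ^ k * f_poly m k) mod Psi m = 1 mod Psi m"
    unfolding f_poly_def w_def[symmetric] by (simp only: power_mult_distrib mod_mult_right_eq)
  then have "Psi m dvd (1 - ?x) ^ k * f_poly m k - 1"
    by (simp add: mod_eq_dvd_iff)
  then obtain h where "(1 - ?x) ^ k * f_poly m k - 1 = Psi m * h" ..
  then show ?thesis by (auto simp: algebra_simps)
qed

text \<open>Multiplying the identity of \<open>f_poly_eq\<close> at x = 1 - z by A gives z^k A f(1 -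
  z) = A + m h(1 - z). Since deg h < k, comparing coefficients of z^k leaves A(0) f(1) on the left
  and only the coefficient of A on the right.\<close>

lemma poly_f_poly_1:
  assumes m: "m \<ge> 2" and k: "k > 0"
    and A: "A * (1 - (1 - fps_X) ^ m) = of_nat m * fps_X"
  shows "poly (f_poly m k) 1 = fps_nth A k"
proof -
  obtain h where h: "(1 - monom 1 1) ^ k * f_poly m k = 1 + Psi m * h"
    using f_poly_eq[of m k] m by auto
  have dPsi: "degree (Psi m) = m - 1"
    using m by (intro degree_Psi) simp
  then have Psi0: "Psi m \<noteq> 0"
    using m by (intro notI) simp
  have dh: "degree h < k"
  proof (cases "h = 0")
    case False
    \<comment> \<open>A zero remainder has degree 0, which is below m - 1 because m \<ge> 2.\<close>
    have "degree (f_poly m k) < m - 1"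
      using degree_mod_less[OF Psi0, of "smult (- (1 / of_nat m)) (monom 1 1 * pderiv (Psi m)) ^ k"] m
      unfolding f_poly_def dPsi by (elim disjE) simp_all
    moreover have "degree ((1 - monom 1 1 :: rat poly) ^ k) \<le> k"
    proof -
      have "degree (1 - monom 1 1 :: rat poly) \<le> 1"
        by (intro degree_diff_le) (auto simp: degree_monom_eq)
      then show ?thesis
        using degree_power_le[of "1 - monom 1 1 :: rat poly" k] by (auto intro: order_trans)
    qed
    moreover have "degree ((1 - monom 1 1) ^ k * f_poly m k)
        \<le> degree ((1 - monom 1 1 :: rat poly) ^ k) + degree (f_poly m k)"
      by (rule degree_mult_le)
    ultimately have "degree ((1 - monom 1 1) ^ k * f_poly m k) < k + (m - 1)"
      by linarith
    moreover have "Psi m * h = (1 - monom 1 1) ^ k * f_poly m k - 1"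
      using h by simp
    ultimately have "degree (Psi m * h) < k + (m - 1)"
      using k by (auto intro!: degree_diff_less)
    then show ?thesis
      using False Psi0 by (simp add: degree_mult_eq dPsi)
  qed (use k in simp)
  let ?q = "[:1, - 1:] :: rat poly"
  \<comment> \<open>\<open>T\<close> expands a polynomial at x = 1 - z as a power series in z. It is
    a ring homomorphism, and its constant coefficient is the value at 1.\<close>
  define T where "T = (\<lambda>p. fps_of_poly (pcompose p ?q))"
  have T_mult: "T (p * q) = T p * T q" for p q
    by (simp add: T_def pcompose_mult fps_of_poly_mult)
  have T_X: "T (monom 1 (Suc 0)) = 1 - fps_X"
    by (simp add: T_def monom_altdef pcompose_pCons)
  have T_1: "T 1 = 1"
    by (simp add: T_def pcompose_1)
  have T_power: "T (p ^ n) = T p ^ n" for p n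
    by (induction n) (simp_all add: T_1 T_mult)
  have T_diff: "T (p - q) = T p - T q" and T_add: "T (p + q) = T p + T q" for p q
    by (simp_all add: T_def pcompose_diff pcompose_add fps_of_poly_diff fps_of_poly_add)
  have T_0: "fps_nth (T p) 0 = poly p 1" for p
    by (simp add: T_def coeff_pcompose_0)
  have "T (monom 1 m) = (1 - fps_X) ^ m"
    using T_power[of "monom 1 1" m] by (simp add: T_X monom_power)
  then have "- (fps_X * T (Psi m)) = (1 - fps_X) ^ m - 1"
    using arg_cong[OF Psi_mult[of m], of T] by (simp add: T_mult T_diff T_X T_1)
  then have Psi_T: "fps_X * T (Psi m) = 1 - (1 - fps_X) ^ m"
    by (metis minus_diff_eq minus_minus)
  have "fps_X * (A * T (Psi m)) = A * (fps_X * T (Psi m))"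
    by (rule mult.left_commute)
  also have "\<dots> = fps_X * of_nat m"
    unfolding Psi_T A by (rule mult.commute)
  finally have APsi: "A * T (Psi m) = of_nat m"
    by simp
  \<comment> \<open>Constant coefficients in \<open>APsi\<close>: A(0) \<Psi>(1) = m, while
    \<Psi>(1) = m is nonzero.\<close>
  have A0: "fps_nth A 0 = 1"
    using arg_cong[OF APsi, of "\<lambda>f. fps_nth f 0"] m by (simp add: T_0 poly_Psi_1)
  have "fps_X ^ k * T (f_poly m k) = 1 + T (Psi m) * T h"
    using arg_cong[OF h, of T] by (simp add: T_mult T_diff T_add T_power T_X T_1)
  then have "A * (fps_X ^ k * T (f_poly m k)) = A + (A * T (Psi m)) * T h"
    by (simp add: algebra_simps)
  then have "fps_X ^ k * (A * T (f_poly m k)) = A + of_nat m * T h"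
    unfolding APsi by (simp only: mult.left_commute)
  then have "fps_nth (fps_X ^ k * (A * T (f_poly m k))) k = fps_nth (A + of_nat m * T h) k"
    by simp
  moreover have "fps_nth (T h) k = 0"
    unfolding T_def fps_of_poly_nth using dh by (intro coeff_eq_0) (simp add: degree_pcompose)
  ultimately show ?thesis
    by (simp add: fps_X_power_mult_nth A0 T_0 fps_of_nat[symmetric])
qed

text \<open>The geometric sum splits off a factor z from 1 - (1 - z)^m; the cofactor has constant
  coefficient m, nonzero in characteristic 0, hence is invertible.\<close>

lemma ex_fps_quotient:
  assumes "m > 0"
  shows "\<exists>A. A * (1 - (1 - fps_X) ^ m) = (of_nat m * fps_X :: 'a::field_char_0 fps)"
proof -
  define S where "S = (\<Sum>i<m. (1 - fps_X :: 'a fps) ^ i)"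
  have "(1 - fps_X :: 'a fps) ^ m - 1 = (1 - fps_X - 1) * S"
    unfolding S_def by (rule power_diff_1_eq)
  then have *: "1 - (1 - fps_X :: 'a fps) ^ m = fps_X * S"
    by (simp add: algebra_simps)
  have "fps_nth S 0 = of_nat m"
    by (simp add: S_def fps_sum_nth fps_nth_power_0)
  then have "inverse S * S = 1"
    using assms by (intro inverse_mult_eq_1) simp
  then have "(of_nat m * inverse S) * (fps_X * S) = of_nat m * fps_X"
    by (simp add: mult_ac)
  then show ?thesis
    unfolding * by blast
qed

theorem theorem6p9:
  fixes m :: nat
  assumes "m \<ge> 2"
  shows "poly (f_poly m 1) 1 = (of_nat m - 1) / 2 \<and>
    (\<forall>k::nat. k \<ge> 2 \<longrightarrow>
      poly (f_poly m k) 1 =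
        1 / fact (k - 1) *
        (\<Sum>j = 2..k. bernoulli j / of_nat j * of_nat (stirling (k - 1) (j - 1)) * (of_nat m ^ j - 1)))"
proof -
  obtain A :: "rat fps" where A: "A * (1 - (1 - fps_X) ^ m) = of_nat m * fps_X"
    using ex_fps_quotient[of m] assms by auto
  define D where "D = bernoulli_diff m oo neg_ln"
  have "fps_X * D = A - 1 - (of_nat m - 1) * fps_X"
    unfolding D_def using A assms by (intro bernoulli_diff_compose_neg_ln) auto
  then have A_eq: "A = 1 + (of_nat m - 1) * fps_X + fps_X * D"
    by (simp add: algebra_simps)
  \<comment> \<open>The factor \<open>fps_X\<close> in front of \<open>D\<close> shifts the index by
    one, and the linear term of \<open>A_eq\<close> contributes only for n = 0.\<close>
  have f: "poly (f_poly m (Suc n)) 1 = (if n = 0 then of_nat m - 1 else 0) + fps_nth D n" for n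
    unfolding poly_f_poly_1[OF assms zero_less_Suc A]
    by (subst A_eq) (simp add: left_diff_distrib fps_of_nat[symmetric])
  \<comment> \<open>The value -1/2 of the first Bernoulli number cancels half of the linear term m -
    1.\<close>
  have "fps_nth D 0 = - (of_nat m - 1) / 2"
    using bernoulli_1 by (simp add: D_def bernoulli_diff_def field_simps)
  then have "poly (f_poly m 1) 1 = (of_nat m - 1) / 2"
    using f[of 0] by (simp add: field_simps)
  moreover have "poly (f_poly m k) 1 = 1 / fact (k - 1) *
      (\<Sum>j = 2..k. bernoulli j / of_nat j * of_nat (stirling (k - 1) (j - 1)) * (of_nat m ^ j - 1))"
    if "k \<ge> 2" for k
  proof -
    define n where "n = k - 1"
    have k: "k = Suc n" and n: "n > 0" using that by (auto simp: n_def)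
    have "fps_nth D n = (\<Sum>j = 0..n. bernoulli (Suc j) * (of_nat m ^ Suc j - 1) / fact (Suc j) *
        (fact j * of_nat (stirling n j) / fact n))"
      by (simp add: D_def fps_compose_nth neg_ln_power_nth bernoulli_diff_def)
    \<comment> \<open>The term j = 0 drops out because \<open>stirling n 0\<close> is 0 for n > 0;
      hence the final sum starts at 2 after the shift by one.\<close>
    also have "\<dots> = (\<Sum>j = 1..n. bernoulli (Suc j) * (of_nat m ^ Suc j - 1) / fact (Suc j) *
        (fact j * of_nat (stirling n j) / fact n))"
      using n by (simp add: sum.atLeast_Suc_atMost)
    also have "\<dots> = (\<Sum>j = 1..n. 1 / fact n * (bernoulli (Suc j) / of_nat (Suc j) *
        of_nat (stirling n j) * (of_nat m ^ Suc j - 1)))"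
      by (intro sum.cong) (simp_all add: field_simps del: of_nat_Suc power_Suc)
    also have "\<dots> = 1 / fact n * (\<Sum>j = Suc 1..Suc n. bernoulli j / of_nat j *
        of_nat (stirling n (j - 1)) * (of_nat m ^ j - 1))"
      by (simp only: sum.shift_bounds_cl_Suc_ivl diff_Suc_1 sum_distrib_left)
    finally show ?thesis
      using f[of n] n by (simp add: k numeral_2_eq_2 del: of_nat_Suc power_Suc)
  qed
  ultimately show ?thesis by blast
qed

end
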